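(* Let $A$ be an associative ring with unit, let $M=\bigoplus_{i=1}^rM_i$ be a direct sum of $r$ simple right $A$-modules, and let $A_M\subseteq E_M$ be the local function ring of $A$ in $M$. Then $A_M$ satisfies the following universal property. There exists a homomorphism $\eta:A\to A_M$ such that $\eta(s)$ is a unit (in $A_M$) whenever $s\in\eta^{-1}(D_M^\ast)$. If $B$ is any other associative ring with a homomorphism $\kappa:A\to B$ such that $\kappa(s)$ is a unit whenever $s\in\eta^{-1}(D_M^\ast)$, and $\ker\eta\subseteq\ker\kappa$, then there exists a unique homomorphism $\rho:A_M\to B$ such that $\eta\circ\rho=\kappa$ (first $\eta$, then $\rho$).
   Context: All rings are associative with unit and homomorphisms are unital. Maps are composed from left to right: $f\circ g$ means first $f$, then $g$; the multiplication in $\operatorname{End}_{\mathbb Z}(M)$ is this composition. A right $A$-module structure on an abelian group $M$ is given by the ring homomorphism (structure morphism) $\eta^A_M:A\to\operatorname{End}_{\mathbb Z}(M)$, $ma=\eta^A_M(a)(m)$. A right module is simple if it is nonzero and has no proper submodule other than $0$. For $M=\bigoplus_{i=1}^rM_i$ put $E_M=\operatorname{End}_{\mathbb Z}(M)=(\operatorname{Hom}_{\mathbb Z}(M_i,M_j))_{1\le i,j\le r}$, viewed as an $r\times r$ matrix ring, and $D_M=\bigoplus_{i=1}^r\operatorname{End}_A(M_i)$, regarded as a subring of $E_M$ by diagonal matrices (each $\operatorname{End}_A(M_i)$ is a division ring). Let $D_M^\ast\subset D_M$ be the set of elements all of whose $r$ components are nonzero, i.e. the set of units of $D_M$. The local function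 ring $A_M$ of $A$ in $M$ is the subring of $E_M$ generated over $\operatorname{im}\eta^A_M$ by the subset $\{\eta^A_M(s)^{-1}\mid s\in A,\ \eta^A_M(s)\in D_M^\ast\subset E_M\}$. For a homomorphism $\eta:A\to A_M$, $\eta^{-1}(D_M^\ast)$ is the set of $s\in A$ with $\eta(s)\in D_M^\ast$ inside $E_M$. *)

theory Defs
  imports "HOL-Algebra.Generated_Rings" "HOL-Algebra.Product_Groups"
begin

text \<open>
  Abelian groups underlying modules are commutative groups in the multiplicative notation of
  \<^theory>\<open>HOL-Algebra.Group\<close>, because this is the setting in which the library provides direct sums
  (\<^const>\<open>sum_group\<close>). Endomorphisms are extensional functions, so that equality in the endomorphism
  ring is equality on the carrier. Maps compose from left to right: the product of \<^term>\<open>f\<close>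
  and \<^term>\<open>g\<close> is first \<^term>\<open>f\<close>, then \<^term>\<open>g\<close>.
\<close>

definition endo_ring :: "('m, 'y) monoid_scheme \<Rightarrow> ('m \<Rightarrow> 'm) ring" where
  "endo_ring M =
    \<lparr>carrier = hom M M \<inter> extensional (carrier M),
     monoid.mult = (\<lambda>f g. compose (carrier M) g f),
     one = (\<lambda>x\<in>carrier M. x),
     zero = (\<lambda>x\<in>carrier M. \<one>\<^bsub>M\<^esub>),
     add = (\<lambda>f g. \<lambda>x\<in>carrier M. f x \<otimes>\<^bsub>M\<^esub> g x)\<rparr>"

text \<open>The element \<^term>\<open>m\<close> multiplied from the right by \<^term>\<open>a\<close> is \<^term>\<open>act a m\<close>.\<close>

locale right_module = ring A + M: comm_group M
  for A :: "('a, 'x) ring_scheme" and M :: "('m, 'y) monoid_scheme" and act :: "'a \<Rightarrow> 'm \<Rightarrow> 'm" +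
  assumes structure_morphism: "act \<in> ring_hom A (endo_ring M)"

definition is_submodule ::
  "('a, 'x) ring_scheme \<Rightarrow> ('m, 'y) monoid_scheme \<Rightarrow> ('a \<Rightarrow> 'm \<Rightarrow> 'm) \<Rightarrow> 'm set \<Rightarrow> bool" where
  "is_submodule A M act N \<longleftrightarrow> subgroup N M \<and> (\<forall>a\<in>carrier A. \<forall>n\<in>N. act a n \<in> N)"

locale simple_right_module = right_module +
  assumes nonzero: "carrier M \<noteq> {\<one>\<^bsub>M\<^esub>}"
    and simple: "is_submodule A M act N \<Longrightarrow> N = {\<one>\<^bsub>M\<^esub>} \<or> N = carrier M"

definition module_endos ::
  "('a, 'x) ring_scheme \<Rightarrow> ('m, 'y) monoid_scheme \<Rightarrow> ('a \<Rightarrow> 'm \<Rightarrow> 'm) \<Rightarrow> ('m \<Rightarrow> 'm) set" where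
  "module_endos A M act =
    {f \<in> carrier (endo_ring M). \<forall>a\<in>carrier A. \<forall>m\<in>carrier M. f (act a m) = act a (f m)}"

text \<open>The endomorphism of the direct sum given by the diagonal matrix with entries \<^term>\<open>d i\<close>.\<close>

definition diag_endo ::
  "'i set \<Rightarrow> ('i \<Rightarrow> ('m, 'y) monoid_scheme) \<Rightarrow> ('i \<Rightarrow> 'm \<Rightarrow> 'm) \<Rightarrow> ('i \<Rightarrow> 'm) \<Rightarrow> ('i \<Rightarrow> 'm)" where
  "diag_endo I M d = (\<lambda>x\<in>carrier (sum_group I M). \<lambda>i\<in>I. d i (x i))"

definition sum_action ::
  "'i set \<Rightarrow> ('i \<Rightarrow> ('m, 'y) monoid_scheme) \<Rightarrow> ('i \<Rightarrow> 'a \<Rightarrow> 'm \<Rightarrow> 'm) \<Rightarrow>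
    'a \<Rightarrow> ('i \<Rightarrow> 'm) \<Rightarrow> ('i \<Rightarrow> 'm)" where
  "sum_action I M act a = diag_endo I M (\<lambda>i. act i a)"

text \<open>
  The diagonal matrices whose entries are nonzero module endomorphisms: for simple modules, the
  units of the ring of diagonal matrices with entries in \<^term>\<open>module_endos A (M i) (act i)\<close>.
\<close>

definition diag_endos_nz ::
  "('a, 'x) ring_scheme \<Rightarrow> 'i set \<Rightarrow> ('i \<Rightarrow> ('m, 'y) monoid_scheme) \<Rightarrow> ('i \<Rightarrow> 'a \<Rightarrow> 'm \<Rightarrow> 'm) \<Rightarrow>
    (('i \<Rightarrow> 'm) \<Rightarrow> ('i \<Rightarrow> 'm)) set" where
  "diag_endos_nz A I M act =
    diag_endo I M `
      {d \<in> \<Pi>\<^sub>E i\<in>I. module_endos A (M i) (act i). \<forall>i\<in>I. d i \<noteq> \<zero>\<^bsub>endo_ring (M i)\<^esub>}"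

definition local_function_ring ::
  "('a, 'x) ring_scheme \<Rightarrow> 'i set \<Rightarrow> ('i \<Rightarrow> ('m, 'y) monoid_scheme) \<Rightarrow> ('i \<Rightarrow> 'a \<Rightarrow> 'm \<Rightarrow> 'm) \<Rightarrow>
    (('i \<Rightarrow> 'm) \<Rightarrow> ('i \<Rightarrow> 'm)) ring" where
  "local_function_ring A I M act =
    (let E = endo_ring (sum_group I M); \<eta> = sum_action I M act in
      E\<lparr>carrier := generate_ring E
        (\<eta> ` carrier A \<union> {inv\<^bsub>E\<^esub> (\<eta> s) | s. s \<in> carrier A \<and> \<eta> s \<in> diag_endos_nz A I M act})\<rparr>)"

lemma endo_ring_simps [simp]:
  "carrier (endo_ring M) = hom M M \<inter> extensional (carrier M)"
  "f \<otimes>\<^bsub>endo_ring M\<^esub> g = compose (carrier M) g f"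
  "\<one>\<^bsub>endo_ring M\<^esub> = (\<lambda>x\<in>carrier M. x)"
  "\<zero>\<^bsub>endo_ring M\<^esub> = (\<lambda>x\<in>carrier M. \<one>\<^bsub>M\<^esub>)"
  "f \<oplus>\<^bsub>endo_ring M\<^esub> g = (\<lambda>x\<in>carrier M. f x \<otimes>\<^bsub>M\<^esub> g x)"
  by (simp_all add: endo_ring_def)

lemma (in comm_group) ring_endo_ring: "ring (endo_ring G)"
proof (rule ringI)
  show "abelian_group (endo_ring G)"
  proof (rule abelian_groupI)
    fix f assume f: "f \<in> carrier (endo_ring G)"
    have "(\<lambda>x\<in>carrier G. inv (f x)) \<in> carrier (endo_ring G)"
      using f by (auto simp: hom_def Pi_iff inv_mult)
    moreover have "(\<lambda>x\<in>carrier G. inv (f x)) \<oplus>\<^bsub>endo_ring G\<^esub> f = \<zero>\<^bsub>endo_ring G\<^esub>"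
      using f by (auto simp: hom_def Pi_iff intro!: restrict_ext)
    ultimately show "\<exists>g\<in>carrier (endo_ring G). g \<oplus>\<^bsub>endo_ring G\<^esub> f = \<zero>\<^bsub>endo_ring G\<^esub>"
      by blast
  qed (auto simp: hom_def Pi_iff m_ac extensional_def fun_eq_iff)
next
  show "Group.monoid (endo_ring G)"
    by (rule monoidI) (auto simp: hom_def Pi_iff compose_def extensional_def fun_eq_iff)
qed (auto simp: hom_def Pi_iff compose_def extensional_def fun_eq_iff)

lemma comm_group_sum_group:
  assumes "\<And>i. i \<in> I \<Longrightarrow> comm_group (M i)"
  shows "comm_group (sum_group I M)"
proof -
  have gr: "group (M i)" if "i \<in> I" for i
    using assms[OF that] by (rule comm_group.axioms)
  show ?thesis
  proof (rule group.group_comm_groupI)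
    fix x y assume "x \<in> carrier (sum_group I M)" "y \<in> carrier (sum_group I M)"
    then have "x i \<in> carrier (M i)" "y i \<in> carrier (M i)" if "i \<in> I" for i
      using that by (auto simp: carrier_sum_group gr)
    then show "x \<otimes>\<^bsub>sum_group I M\<^esub> y = y \<otimes>\<^bsub>sum_group I M\<^esub> x"
      by (auto intro!: restrict_ext comm_monoid.m_comm comm_group.axioms(1) assms)
  qed (simp add: gr)
qed

lemma right_module_sum_group:
  assumes A: "ring A" and I: "finite I" and M: "\<And>i. i \<in> I \<Longrightarrow> right_module A (M i) (act i)"
  shows "right_module A (sum_group I M) (sum_action I M act)"
proof -
  have cg: "comm_group (M i)" if "i \<in> I" for i
    using M[OF that] by (rule right_module.axioms)
  have gr: "group (M i)" if "i \<in> I" for i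
    using cg[OF that] by (rule comm_group.axioms)
  have car: "carrier (sum_group I M) = (\<Pi>\<^sub>E i\<in>I. carrier (M i))"
    using I by (simp add: carrier_sum_group gr)
  have hom: "act i \<in> ring_hom A (endo_ring (M i))" if "i \<in> I" for i
    using M[OF that] by (rule right_module.structure_morphism)
  have act_hom: "act i a \<in> hom (M i) (M i)" if "i \<in> I" "a \<in> carrier A" for i a
    using ring_hom_closed[OF hom that(2)] that by simp
  have cl: "act i a x \<in> carrier (M i)" if "i \<in> I" "a \<in> carrier A" "x \<in> carrier (M i)" for i a x
    using hom_in_carrier[OF act_hom] that by blast
  have "sum_action I M act \<in> ring_hom A (endo_ring (sum_group I M))"
  proof (rule ring_hom_memI)
    fix a assume a: "a \<in> carrier A"
    show "sum_action I M act a \<in> carrier (endo_ring (sum_group I M))"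
    proof -
      have "sum_action I M act a \<in> hom (sum_group I M) (sum_group I M)"
      proof (rule homI)
        fix x assume "x \<in> carrier (sum_group I M)"
        then show "sum_action I M act a x \<in> carrier (sum_group I M)"
          using a by (auto simp: sum_action_def diag_endo_def car intro!: cl dest: PiE_mem)
      next
        fix x y assume x: "x \<in> carrier (sum_group I M)" and y: "y \<in> carrier (sum_group I M)"
        have xy: "x i \<in> carrier (M i)" "y i \<in> carrier (M i)" if "i \<in> I" for i
          using x y that by (auto simp: car)
        have "x \<otimes>\<^bsub>sum_group I M\<^esub> y \<in> carrier (sum_group I M)"
          using xy by (auto simp: car intro!: monoid.m_closed group.is_monoid gr)
        then show "sum_action I M act a (x \<otimes>\<^bsub>sum_group I M\<^esub> y)
            = sum_action I M act a x \<otimes>\<^bsub>sum_group I M\<^esub> sum_action I M act a y"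
          using a x y xy by (auto simp: sum_action_def diag_endo_def
              intro!: restrict_ext hom_mult[OF act_hom])
      qed
      then show ?thesis
        by (simp add: sum_action_def diag_endo_def)
    qed
    fix b assume b: "b \<in> carrier A"
    show "sum_action I M act (a \<otimes>\<^bsub>A\<^esub> b)
        = sum_action I M act a \<otimes>\<^bsub>endo_ring (sum_group I M)\<^esub> sum_action I M act b"
    proof
      fix x
      have mem: "x i \<in> carrier (M i)" if "x \<in> carrier (sum_group I M)" "i \<in> I" for i
        using that by (auto simp: car)
      have cod: "(\<lambda>i\<in>I. act i a (x i)) \<in> carrier (sum_group I M)" if "x \<in> carrier (sum_group I M)"
        using a mem[OF that] by (simp add: car cl)
      show "sum_action I M act (a \<otimes>\<^bsub>A\<^esub> b) x
          = (sum_action I M act a \<otimes>\<^bsub>endo_ring (sum_group I M)\<^esub> sum_action I M act b) x"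
        using a b mem cod by (auto simp: sum_action_def diag_endo_def compose_def
            ring_hom_mult[OF hom] intro!: restrict_ext)
    qed
    show "sum_action I M act (a \<oplus>\<^bsub>A\<^esub> b)
        = sum_action I M act a \<oplus>\<^bsub>endo_ring (sum_group I M)\<^esub> sum_action I M act b"
      using a b by (auto simp: sum_action_def diag_endo_def car PiE_mem
          ring_hom_add[OF hom] intro!: restrict_ext)
  next
    show "sum_action I M act \<one>\<^bsub>A\<^esub> = \<one>\<^bsub>endo_ring (sum_group I M)\<^esub>"
      by (auto simp: sum_action_def diag_endo_def car PiE_mem ring_hom_one[OF hom]
          extensional_def PiE_def fun_eq_iff Pi_iff)
  qed
  then show ?thesis
    using A comm_group_sum_group[of I M] cg
    by (simp add: right_module_def right_module_axioms_def)
qed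

end

theory Submission
  imports Defs
begin

text \<open>
  If \<open>\<eta> s\<close> is diagonal with entries in the \<open>End\<^sub>A(M\<^sub>i)\<close>, it commutes with the image of
  \<open>\<eta>\<close>; by Schur's lemma it is a unit of \<open>E\<^sub>M\<close> as soon as its components are
  nonzero. Hence \<open>A\<^sub>M\<close> is a localization of the image of \<open>\<eta>\<close> at central elements: every
  \<open>x\<close> in \<open>A\<^sub>M\<close> is a fraction, \<open>x \<eta>(t) = \<eta>(a)\<close>, and \<open>\<rho> x\<close> has to be the
  solution \<open>y\<close> of \<open>y \<kappa>(t) = \<kappa>(a)\<close>. Cross-multiplication and
  the inclusion of kernels show that \<open>y\<close> depends only on \<open>x\<close>.
\<close>

section \<open>Central fractions\<close>

text \<open>\<open>E\<close> is the ambient ring, later the full endomorphism ring of the direct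
  sum; the local function ring enters only as a generated subring of it. \<open>kernel_le\<close> is
  the inclusion of kernels, stated elementwise.\<close>

locale ring_hom_pair = A: ring A + E: ring E + B: ring B
  for A :: "('a, 'x) ring_scheme" and E :: "('e, 'z) ring_scheme" and B :: "('b, 'w) ring_scheme" +
  fixes \<eta> :: "'a \<Rightarrow> 'e" and \<kappa> :: "'a \<Rightarrow> 'b"
  assumes hom_\<eta>: "\<eta> \<in> ring_hom A E"
    and hom_\<kappa>: "\<kappa> \<in> ring_hom A B"
    and kernel_le: "\<lbrakk>a \<in> carrier A; \<eta> a = \<zero>\<^bsub>E\<^esub>\<rbrakk> \<Longrightarrow> \<kappa> a = \<zero>\<^bsub>B\<^esub>"
begin

sublocale \<eta>: ring_hom_ring A E \<eta>
  by (rule ring_hom_ringI2) (rule A.ring_axioms E.ring_axioms hom_\<eta>)+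

sublocale \<kappa>: ring_hom_ring A B \<kappa>
  by (rule ring_hom_ringI2) (rule A.ring_axioms B.ring_axioms hom_\<kappa>)+

text \<open>The difference of \<open>a\<close> and \<open>b\<close> lies in the kernel of \<eta>,
  hence in that of \<kappa>. This is the only way in which the inclusion of kernels enters:
  identities between elements of the image of \<eta> are carried over to \<open>B\<close>.\<close>

lemma eq_transfer:
  assumes "a \<in> carrier A" "b \<in> carrier A" "\<eta> a = \<eta> b"
  shows "\<kappa> a = \<kappa> b"
proof -
  have "\<eta> (a \<ominus>\<^bsub>A\<^esub> b) = \<zero>\<^bsub>E\<^esub>"
    using assms by (simp add: a_minus_def E.r_neg)
  then have "\<kappa> (a \<ominus>\<^bsub>A\<^esub> b) = \<zero>\<^bsub>B\<^esub>"
    using assms by (intro kernel_le) auto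
  then have "\<kappa> a \<ominus>\<^bsub>B\<^esub> \<kappa> b = \<zero>\<^bsub>B\<^esub>"
    using assms by (simp add: a_minus_def)
  then show ?thesis
    using assms by simp
qed

text \<open>Collects everything that a denominator has to satisfy, so that the set is closed under
  products. Centrality is asked only relative to the image of \<eta>, not in all of
  \<open>E\<close>.\<close>

definition denominators :: "'a set" where
  "denominators = {t \<in> carrier A. \<eta> t \<in> Units E \<and> \<kappa> t \<in> Units B \<and>
    (\<forall>a\<in>carrier A. \<eta> t \<otimes>\<^bsub>E\<^esub> \<eta> a = \<eta> a \<otimes>\<^bsub>E\<^esub> \<eta> t)}"

text \<open>The graph of the future \<rho>: \<open>x\<close> and \<open>y\<close> are the fractions
  "\<open>a\<close> over \<open>t\<close>" formed in \<open>E\<close> and in \<open>B\<close> with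
  the same \<open>a\<close> and \<open>t\<close>. As a relation it can be handled before it is known
  to be single-valued.\<close>

definition fraction_rel :: "'e \<Rightarrow> 'b \<Rightarrow> bool" where
  "fraction_rel x y \<longleftrightarrow> x \<in> carrier E \<and> y \<in> carrier B \<and>
    (\<exists>a\<in>carrier A. \<exists>t\<in>denominators. x \<otimes>\<^bsub>E\<^esub> \<eta> t = \<eta> a \<and> y \<otimes>\<^bsub>B\<^esub> \<kappa> t = \<kappa> a)"

lemma denominatorsD:
  assumes "t \<in> denominators"
  shows "t \<in> carrier A" "\<eta> t \<in> Units E" "\<kappa> t \<in> Units B"
    and "a \<in> carrier A \<Longrightarrow> \<eta> t \<otimes>\<^bsub>E\<^esub> \<eta> a = \<eta> a \<otimes>\<^bsub>E\<^esub> \<eta> t"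
  using assms by (auto simp: denominators_def)

text \<open>Commutation in \<open>B\<close> is not part of the definition of a denominator; it is
  inherited from \<open>E\<close> through \<open>eq_transfer\<close>.\<close>

lemma denominators_commute:
  assumes t: "t \<in> denominators" and a: "a \<in> carrier A"
  shows "\<kappa> t \<otimes>\<^bsub>B\<^esub> \<kappa> a = \<kappa> a \<otimes>\<^bsub>B\<^esub> \<kappa> t"
  using eq_transfer[of "t \<otimes>\<^bsub>A\<^esub> a" "a \<otimes>\<^bsub>A\<^esub> t"] denominatorsD[OF t] a by simp

lemma denominators_one: "\<one>\<^bsub>A\<^esub> \<in> denominators"
  by (simp add: denominators_def)

text \<open>Supplies common denominators. An element of the image of \<eta> is moved past the two
  factors one at a time.\<close>

lemma denominators_mult:
  assumes "s \<in> denominators" "t \<in> denominators"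
  shows "s \<otimes>\<^bsub>A\<^esub> t \<in> denominators"
proof -
  note s = denominatorsD[OF assms(1)] and t = denominatorsD[OF assms(2)]
  have "\<eta> s \<otimes>\<^bsub>E\<^esub> \<eta> t \<otimes>\<^bsub>E\<^esub> \<eta> a = \<eta> a \<otimes>\<^bsub>E\<^esub> (\<eta> s \<otimes>\<^bsub>E\<^esub> \<eta> t)"
    if "a \<in> carrier A" for a
    using s(1) t(1) s(4)[OF that] t(4)[OF that] that
    by (metis E.m_assoc \<eta>.hom_closed)
  then show ?thesis
    using s(1-3) t(1-3) by (simp add: denominators_def)
qed

section \<open>Arithmetic of fractions\<close>

lemma fraction_relI:
  assumes "x \<in> carrier E" "y \<in> carrier B" "a \<in> carrier A" "t \<in> denominators"
    and "x \<otimes>\<^bsub>E\<^esub> \<eta> t = \<eta> a" "y \<otimes>\<^bsub>B\<^esub> \<kappa> t = \<kappa> a"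
  shows "fraction_rel x y"
  using assms unfolding fraction_rel_def by blast

lemma fraction_relE:
  assumes "fraction_rel x y"
  obtains a t where "x \<in> carrier E" "y \<in> carrier B" "a \<in> carrier A" "t \<in> denominators"
    "x \<otimes>\<^bsub>E\<^esub> \<eta> t = \<eta> a" "y \<otimes>\<^bsub>B\<^esub> \<kappa> t = \<kappa> a"
  using assms unfolding fraction_rel_def by blast

lemma fraction_rel_hom:
  assumes "a \<in> carrier A"
  shows "fraction_rel (\<eta> a) (\<kappa> a)"
  using assms denominators_one by (intro fraction_relI[of _ _ a "\<one>\<^bsub>A\<^esub>"]) auto

lemma fraction_rel_inv:
  assumes "t \<in> denominators"
  shows "fraction_rel (inv\<^bsub>E\<^esub> (\<eta> t)) (inv\<^bsub>B\<^esub> (\<kappa> t))"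
  using assms denominatorsD[OF assms] by (intro fraction_relI[of _ _ "\<one>\<^bsub>A\<^esub>" t]) auto

lemma fraction_rel_neg:
  assumes "fraction_rel x y"
  shows "fraction_rel (\<ominus>\<^bsub>E\<^esub> x) (\<ominus>\<^bsub>B\<^esub> y)"
  using assms
proof (rule fraction_relE)
  fix a t
  assume "x \<in> carrier E" "y \<in> carrier B" and a: "a \<in> carrier A" and t: "t \<in> denominators"
    and "x \<otimes>\<^bsub>E\<^esub> \<eta> t = \<eta> a" "y \<otimes>\<^bsub>B\<^esub> \<kappa> t = \<kappa> a"
  then show ?thesis
    using denominatorsD(1)[OF t]
    by (intro fraction_relI[of _ _ "\<ominus>\<^bsub>A\<^esub> a" t]) (auto simp: E.l_minus B.l_minus)
qed

lemma fraction_rel_add_mult: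
  assumes "fraction_rel x y" "fraction_rel x' y'"
  shows "fraction_rel (x \<oplus>\<^bsub>E\<^esub> x') (y \<oplus>\<^bsub>B\<^esub> y')" (is ?add)
    and "fraction_rel (x \<otimes>\<^bsub>E\<^esub> x') (y \<otimes>\<^bsub>B\<^esub> y')" (is ?mult)
proof -
  obtain a t where x: "x \<in> carrier E" "y \<in> carrier B" and a: "a \<in> carrier A"
    and t: "t \<in> denominators" and eq: "x \<otimes>\<^bsub>E\<^esub> \<eta> t = \<eta> a" "y \<otimes>\<^bsub>B\<^esub> \<kappa> t = \<kappa> a"
    using assms(1) by (rule fraction_relE)
  obtain a' t' where x': "x' \<in> carrier E" "y' \<in> carrier B" and a': "a' \<in> carrier A"
    and t': "t' \<in> denominators" and eq': "x' \<otimes>\<^bsub>E\<^esub> \<eta> t' = \<eta> a'" "y' \<otimes>\<^bsub>B\<^esub> \<kappa> t' = \<kappa> a'"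
    using assms(2) by (rule fraction_relE)
  note tA = denominatorsD(1)[OF t] and tA' = denominatorsD(1)[OF t']
  \<comment> \<open>Over the common denominator \<open>t t'\<close>, the first fraction has
    numerator \<open>a t'\<close> at once; the second needs \<open>t\<close> and \<open>t'\<close>
    interchanged to get \<open>a' t\<close>. The same computation is then made in
    \<open>B\<close>.\<close>
  have E_swap: "x' \<otimes>\<^bsub>E\<^esub> (\<eta> t \<otimes>\<^bsub>E\<^esub> \<eta> t') = \<eta> a' \<otimes>\<^bsub>E\<^esub> \<eta> t"
    using x' tA tA' denominatorsD(4)[OF t tA'] by (simp add: E.m_assoc flip: eq')
  have B_swap: "y' \<otimes>\<^bsub>B\<^esub> (\<kappa> t \<otimes>\<^bsub>B\<^esub> \<kappa> t') = \<kappa> a' \<otimes>\<^bsub>B\<^esub> \<kappa> t"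
    using x' tA tA' denominators_commute[OF t tA'] by (simp add: B.m_assoc flip: eq')
  have E_add: "(x \<oplus>\<^bsub>E\<^esub> x') \<otimes>\<^bsub>E\<^esub> (\<eta> t \<otimes>\<^bsub>E\<^esub> \<eta> t') = \<eta> a \<otimes>\<^bsub>E\<^esub> \<eta> t' \<oplus>\<^bsub>E\<^esub> \<eta> a' \<otimes>\<^bsub>E\<^esub> \<eta> t"
    using x x' tA tA' by (simp add: E.l_distr E_swap E.m_assoc flip: eq(1))
  have B_add: "(y \<oplus>\<^bsub>B\<^esub> y') \<otimes>\<^bsub>B\<^esub> (\<kappa> t \<otimes>\<^bsub>B\<^esub> \<kappa> t') = \<kappa> a \<otimes>\<^bsub>B\<^esub> \<kappa> t' \<oplus>\<^bsub>B\<^esub> \<kappa> a' \<otimes>\<^bsub>B\<^esub> \<kappa> t"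
    using x x' tA tA' by (simp add: B.l_distr B_swap B.m_assoc flip: eq(2))
  show ?add
    using x x' a a' tA tA' E_add B_add denominators_mult[OF t t']
    by (intro fraction_relI[of _ _ "a \<otimes>\<^bsub>A\<^esub> t' \<oplus>\<^bsub>A\<^esub> a' \<otimes>\<^bsub>A\<^esub> t" "t \<otimes>\<^bsub>A\<^esub> t'"]) auto
  \<comment> \<open>Centrality of \<open>t\<close> lets it pass the numerator \<open>a'\<close>:
    \<open>x x' t t' = x a' t = x t a' = a a'\<close>.\<close>
  have "x \<otimes>\<^bsub>E\<^esub> x' \<otimes>\<^bsub>E\<^esub> (\<eta> t \<otimes>\<^bsub>E\<^esub> \<eta> t') = x \<otimes>\<^bsub>E\<^esub> (\<eta> t \<otimes>\<^bsub>E\<^esub> \<eta> a')"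
    using x x' tA tA' a' E_swap denominatorsD(4)[OF t a'] by (simp add: E.m_assoc)
  then have E_mult: "x \<otimes>\<^bsub>E\<^esub> x' \<otimes>\<^bsub>E\<^esub> (\<eta> t \<otimes>\<^bsub>E\<^esub> \<eta> t') = \<eta> a \<otimes>\<^bsub>E\<^esub> \<eta> a'"
    using x tA a' by (simp add: E.m_assoc flip: eq)
  have "y \<otimes>\<^bsub>B\<^esub> y' \<otimes>\<^bsub>B\<^esub> (\<kappa> t \<otimes>\<^bsub>B\<^esub> \<kappa> t') = y \<otimes>\<^bsub>B\<^esub> (\<kappa> t \<otimes>\<^bsub>B\<^esub> \<kappa> a')"
    using x x' tA tA' a' B_swap denominators_commute[OF t a'] by (simp add: B.m_assoc)
  then have B_mult: "y \<otimes>\<^bsub>B\<^esub> y' \<otimes>\<^bsub>B\<^esub> (\<kappa> t \<otimes>\<^bsub>B\<^esub> \<kappa> t') = \<kappa> a \<otimes>\<^bsub>B\<^esub> \<kappa> a'"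
    using x tA a' by (simp add: B.m_assoc flip: eq)
  show ?mult
    using x x' a a' tA tA' E_mult B_mult denominators_mult[OF t t']
    by (intro fraction_relI[of _ _ "a \<otimes>\<^bsub>A\<^esub> a'" "t \<otimes>\<^bsub>A\<^esub> t'"]) auto
qed

text \<open>Makes \<rho> well defined. Two representations of \<open>x\<close> are cross-multiplied
  in \<open>E\<close>, the resulting equation is transferred to \<open>B\<close>, and the unit
  \<open>\<kappa> t \<kappa> t'\<close> is cancelled there.\<close>

lemma fraction_rel_unique:
  assumes "fraction_rel x y" "fraction_rel x y'"
  shows "y = y'"
proof -
  obtain a t where x: "x \<in> carrier E" "y \<in> carrier B" and a: "a \<in> carrier A"
    and t: "t \<in> denominators" and eq: "x \<otimes>\<^bsub>E\<^esub> \<eta> t = \<eta> a" "y \<otimes>\<^bsub>B\<^esub> \<kappa> t = \<kappa> a"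
    using assms(1) by (rule fraction_relE)
  obtain a' t' where y': "y' \<in> carrier B" and a': "a' \<in> carrier A"
    and t': "t' \<in> denominators" and eq': "x \<otimes>\<^bsub>E\<^esub> \<eta> t' = \<eta> a'" "y' \<otimes>\<^bsub>B\<^esub> \<kappa> t' = \<kappa> a'"
    using assms(2) by (rule fraction_relE)
  note tA = denominatorsD(1)[OF t] and tA' = denominatorsD(1)[OF t']
  \<comment> \<open>Both sides equal \<open>x\<close> times the product of the two commuting
    denominators.\<close>
  have "\<eta> a \<otimes>\<^bsub>E\<^esub> \<eta> t' = \<eta> a' \<otimes>\<^bsub>E\<^esub> \<eta> t"
    using x tA tA' denominatorsD(4)[OF t tA'] by (simp add: E.m_assoc flip: eq eq')
  then have "\<kappa> a \<otimes>\<^bsub>B\<^esub> \<kappa> t' = \<kappa> a' \<otimes>\<^bsub>B\<^esub> \<kappa> t"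
    using eq_transfer[of "a \<otimes>\<^bsub>A\<^esub> t'" "a' \<otimes>\<^bsub>A\<^esub> t"] a a' tA tA' by simp
  then have eq_u: "y \<otimes>\<^bsub>B\<^esub> (\<kappa> t \<otimes>\<^bsub>B\<^esub> \<kappa> t') = y' \<otimes>\<^bsub>B\<^esub> (\<kappa> t \<otimes>\<^bsub>B\<^esub> \<kappa> t')"
    using x y' tA tA' denominators_commute[OF t tA'] by (simp add: B.m_assoc flip: eq eq')
  define u where "u = \<kappa> t \<otimes>\<^bsub>B\<^esub> \<kappa> t'"
  have u: "u \<in> Units B"
    using denominatorsD(3)[OF t] denominatorsD(3)[OF t'] by (simp add: u_def)
  have "y \<otimes>\<^bsub>B\<^esub> u \<otimes>\<^bsub>B\<^esub> inv\<^bsub>B\<^esub> u = y' \<otimes>\<^bsub>B\<^esub> u \<otimes>\<^bsub>B\<^esub> inv\<^bsub>B\<^esub> u"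
    using eq_u by (simp add: u_def)
  then show ?thesis
    using x y' u by (simp add: B.m_assoc B.Units_closed)
qed

text \<open>The elements that are fractions include the generators and are closed under the
  operations that generate the subring, so induction over \<open>generate_ring\<close>
  applies.\<close>

lemma fraction_rel_generated:
  assumes "S \<subseteq> denominators"
    and "x \<in> generate_ring E (\<eta> ` carrier A \<union> (\<lambda>s. inv\<^bsub>E\<^esub> (\<eta> s)) ` S)"
  shows "\<exists>y. fraction_rel x y"
  using assms(2)
proof (induction rule: generate_ring.induct)
  case one
  then show ?case
    using fraction_rel_hom[of "\<one>\<^bsub>A\<^esub>"] by auto
next
  case (incl h)
  then show ?case
    using fraction_rel_hom fraction_rel_inv assms(1) by blast
qed (blast intro: fraction_rel_neg fraction_rel_add_mult)+

theorem ex1_hom_from_generated: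
  assumes S: "S \<subseteq> denominators"
  defines "K \<equiv> generate_ring E (\<eta> ` carrier A \<union> (\<lambda>s. inv\<^bsub>E\<^esub> (\<eta> s)) ` S)"
  shows "\<exists>!\<rho>. \<rho> \<in> ring_hom (E\<lparr>carrier := K\<rparr>) B \<inter> extensional K \<and>
    (\<forall>a\<in>carrier A. \<rho> (\<eta> a) = \<kappa> a)"
proof -
  \<comment> \<open>The choice is forced by \<open>fraction_rel_unique\<close>; the restriction to
    \<open>K\<close> makes \<rho> extensional.\<close>
  define \<rho> where "\<rho> = (\<lambda>x\<in>K. SOME y. fraction_rel x y)"
  have \<rho>: "fraction_rel x (\<rho> x)" if "x \<in> K" for x
    using someI_ex[OF fraction_rel_generated[OF S, of x]] that by (simp add: \<rho>_def K_def)
  \<comment> \<open>From here on a value of \<rho> is computed by exhibiting any related element, so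
    the homomorphism laws reduce to the arithmetic of fractions.\<close>
  then have \<rho>_eq: "\<rho> x = y" if "x \<in> K" "fraction_rel x y" for x y
    using fraction_rel_unique that by blast
  have img: "\<eta> a \<in> K" if "a \<in> carrier A" for a
    using that by (auto simp: K_def intro: generate_ring.incl)
  show ?thesis
  proof (rule ex1I[of _ \<rho>])
    have "\<rho> \<in> ring_hom (E\<lparr>carrier := K\<rparr>) B"
    proof (rule ring_hom_memI)
      show "\<rho> x \<in> carrier B" if "x \<in> carrier (E\<lparr>carrier := K\<rparr>)" for x
        using \<rho>[of x] that by (auto elim: fraction_relE)
    next
      fix x y assume xy: "x \<in> carrier (E\<lparr>carrier := K\<rparr>)" "y \<in> carrier (E\<lparr>carrier := K\<rparr>)"
      then have "x \<otimes>\<^bsub>E\<^esub> y \<in> K" "x \<oplus>\<^bsub>E\<^esub> y \<in> K"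
        by (auto simp: K_def intro: generate_ring.intros)
      then show "\<rho> (x \<otimes>\<^bsub>E\<lparr>carrier := K\<rparr>\<^esub> y) = \<rho> x \<otimes>\<^bsub>B\<^esub> \<rho> y"
        and "\<rho> (x \<oplus>\<^bsub>E\<lparr>carrier := K\<rparr>\<^esub> y) = \<rho> x \<oplus>\<^bsub>B\<^esub> \<rho> y"
        using xy by (simp_all add: \<rho>_eq \<rho> fraction_rel_add_mult)
    next
      show "\<rho> \<one>\<^bsub>E\<lparr>carrier := K\<rparr>\<^esub> = \<one>\<^bsub>B\<^esub>"
        using img[of "\<one>\<^bsub>A\<^esub>"] fraction_rel_hom[of "\<one>\<^bsub>A\<^esub>"] by (simp add: \<rho>_eq)
    qed
    moreover have "\<rho> \<in> extensional K"
      by (simp add: \<rho>_def)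
    ultimately show "\<rho> \<in> ring_hom (E\<lparr>carrier := K\<rparr>) B \<inter> extensional K \<and>
        (\<forall>a\<in>carrier A. \<rho> (\<eta> a) = \<kappa> a)"
      using img fraction_rel_hom \<rho>_eq by blast
  next
    fix \<sigma>
    assume \<sigma>: "\<sigma> \<in> ring_hom (E\<lparr>carrier := K\<rparr>) B \<inter> extensional K \<and> (\<forall>a\<in>carrier A. \<sigma> (\<eta> a) = \<kappa> a)"
    show "\<sigma> = \<rho>"
    proof (rule extensionalityI[of _ K])
      fix x assume x: "x \<in> K"
      obtain a t where at: "x \<in> carrier E" "a \<in> carrier A" "t \<in> denominators" "x \<otimes>\<^bsub>E\<^esub> \<eta> t = \<eta> a"
        using \<rho>[OF x] by (rule fraction_relE)
      note tA = denominatorsD(1)[OF at(3)]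
      \<comment> \<open>Applying \<sigma> to \<open>x \<eta>(t) = \<eta>(a)\<close> gives
        \<open>\<sigma>(x) \<kappa>(t) = \<kappa>(a)\<close>, so \<open>\<sigma> x\<close> is
        related to \<open>x\<close> by the same \<open>a\<close> and \<open>t\<close>.\<close>
      have "\<sigma> (x \<otimes>\<^bsub>E\<^esub> \<eta> t) = \<sigma> x \<otimes>\<^bsub>B\<^esub> \<sigma> (\<eta> t)"
        using \<sigma> x img[OF tA] ring_hom_mult[of \<sigma> "E\<lparr>carrier := K\<rparr>" B x "\<eta> t"] by simp
      moreover have "\<sigma> x \<in> carrier B"
        using \<sigma> x ring_hom_closed[of \<sigma> "E\<lparr>carrier := K\<rparr>" B x] by simp
      ultimately have "fraction_rel x (\<sigma> x)"
        using \<sigma> at tA by (intro fraction_relI[of _ _ a t]) auto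
      then show "\<sigma> x = \<rho> x"
        using \<rho>_eq x by simp
    qed (use \<sigma> in \<open>auto simp: \<rho>_def\<close>)
  qed
qed

end

section \<open>Diagonal endomorphisms\<close>

lemma (in comm_group) endo_ring_UnitsI:
  assumes f: "f \<in> carrier (endo_ring G)" and bij: "bij_betw f (carrier G) (carrier G)"
  shows "f \<in> Units (endo_ring G)"
proof -
  \<comment> \<open>The inverse map is restricted because elements of \<open>endo_ring\<close> are
    extensional; that it is a homomorphism comes from the inverse of a group isomorphism.\<close>
  define g where "g = restrict (inv_into (carrier G) f) (carrier G)"
  have "f \<in> iso G G"
    using f bij by (simp add: iso_def)
  then have "inv_into (carrier G) f \<in> hom G G"
    using iso_set_sym by (auto simp: iso_def)
  then have "g \<in> carrier (endo_ring G)"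
    by (auto simp: g_def hom_def Pi_iff)
  moreover have "g \<otimes>\<^bsub>endo_ring G\<^esub> f = \<one>\<^bsub>endo_ring G\<^esub>" "f \<otimes>\<^bsub>endo_ring G\<^esub> g = \<one>\<^bsub>endo_ring G\<^esub>"
    using f bij
    by (auto simp: g_def compose_def bij_betw_inv_into_left bij_betw_inv_into_right bij_betwE
        intro!: restrict_ext)
  ultimately show ?thesis
    using f unfolding Units_def by blast
qed

text \<open>Kernel and image of \<open>d\<close> are submodules. As \<open>d\<close> is not zero,
  the kernel is not everything and the image is not trivial, so simplicity makes \<open>d\<close>
  injective and surjective.\<close>

lemma (in simple_right_module) schur:
  assumes d: "d \<in> module_endos A M act" and nz: "d \<noteq> \<zero>\<^bsub>endo_ring M\<^esub>"
  shows "bij_betw d (carrier M) (carrier M)"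
proof -
  have hom: "d \<in> hom M M" and ext: "d \<in> extensional (carrier M)"
    and lin: "\<And>a m. \<lbrakk>a \<in> carrier A; m \<in> carrier M\<rbrakk> \<Longrightarrow> d (act a m) = act a (d m)"
    using d by (auto simp: module_endos_def)
  interpret d: group_hom M M d
    using hom by unfold_locales
  have act: "act a \<in> hom M M" if "a \<in> carrier A" for a
    using ring_hom_closed[OF structure_morphism that] by simp
  have act_cl: "act a m \<in> carrier M" if "a \<in> carrier A" "m \<in> carrier M" for a m
    using hom_in_carrier[OF act] that by blast
  have act_one: "act a \<one>\<^bsub>M\<^esub> = \<one>\<^bsub>M\<^esub>" if "a \<in> carrier A" for a
    using hom_one[OF act[OF that]] by (simp add: M.is_group)
  \<comment> \<open>Extensionality is what turns vanishing on the carrier into equality with the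
    zero of \<open>endo_ring\<close>.\<close>
  have not_triv: "\<not> (\<forall>m\<in>carrier M. d m = \<one>\<^bsub>M\<^esub>)"
  proof
    assume "\<forall>m\<in>carrier M. d m = \<one>\<^bsub>M\<^esub>"
    then have "d = \<zero>\<^bsub>endo_ring M\<^esub>"
      using ext by (auto intro: extensionalityI[of _ "carrier M"])
    with nz show False ..
  qed
  have "is_submodule A M act (kernel M M d)"
    using d.subgroup_kernel by (auto simp: is_submodule_def kernel_def act_cl lin act_one)
  then have "kernel M M d = {\<one>\<^bsub>M\<^esub>}"
    using simple not_triv by (auto simp: kernel_def)
  moreover have "is_submodule A M act (d ` carrier M)"
    using d.img_is_subgroup lin[symmetric] act_cl
    by (auto simp: is_submodule_def)
  then have "d ` carrier M = carrier M"
    using simple not_triv by blast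
  ultimately have "d \<in> iso M M"
    using hom by (simp add: iso_kernel_image M.is_group)
  then show ?thesis
    by (simp add: iso_def)
qed

lemma bij_betw_diag_endo:
  assumes I: "finite I" and gr: "\<And>i. i \<in> I \<Longrightarrow> group (M i)"
    and d: "\<And>i. i \<in> I \<Longrightarrow> bij_betw (d i) (carrier (M i)) (carrier (M i))"
  shows "bij_betw (diag_endo I M d) (carrier (sum_group I M)) (carrier (sum_group I M))"
proof -
  \<comment> \<open>For finite \<open>I\<close> the finite-support condition of the direct sum is
    vacuous, which leaves the full product.\<close>
  have car: "carrier (sum_group I M) = (\<Pi>\<^sub>E i\<in>I. carrier (M i))"
    using I gr by (simp add: carrier_sum_group)
  have d_cl: "d i (x i) \<in> carrier (M i)" if "x \<in> (\<Pi>\<^sub>E i\<in>I. carrier (M i))" "i \<in> I" for x i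
    using bij_betwE[OF d[OF that(2)]] PiE_mem[OF that] by blast
  \<comment> \<open>The inverse of a diagonal matrix is taken entry by entry.\<close>
  define e where "e x = (\<lambda>i\<in>I. inv_into (carrier (M i)) (d i) (x i))" for x
  show ?thesis
  proof (rule bij_betw_byWitness[where f' = e])
    show "\<forall>x\<in>carrier (sum_group I M). e (diag_endo I M d x) = x"
    proof
      fix x assume x: "x \<in> carrier (sum_group I M)"
      then show "e (diag_endo I M d x) = x"
        by (intro extensionalityI[of _ I])
          (auto simp: e_def diag_endo_def car PiE_mem PiE_iff bij_betw_inv_into_left[OF d])
    qed
    have e_car: "e x \<in> carrier (sum_group I M)" if "x \<in> carrier (sum_group I M)" for x
      using that bij_betwE[OF bij_betw_inv_into[OF d]] by (auto simp: e_def car PiE_mem)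
    then show "e ` carrier (sum_group I M) \<subseteq> carrier (sum_group I M)"
      by blast
    show "diag_endo I M d ` carrier (sum_group I M) \<subseteq> carrier (sum_group I M)"
      using d_cl by (auto simp: diag_endo_def car PiE_mem)
    show "\<forall>x\<in>carrier (sum_group I M). diag_endo I M d (e x) = x"
    proof
      fix x assume x: "x \<in> carrier (sum_group I M)"
      then show "diag_endo I M d (e x) = x"
        using e_car[OF x] by (intro extensionalityI[of _ I])
          (auto simp: e_def diag_endo_def car PiE_mem PiE_iff bij_betw_inv_into_right[OF d])
    qed
  qed
qed

lemma diag_endos_nz_bij:
  assumes I: "finite I" and M: "\<And>i. i \<in> I \<Longrightarrow> simple_right_module A (M i) (act i)"
    and f: "f \<in> diag_endos_nz A I M act"
  shows "bij_betw f (carrier (sum_group I M)) (carrier (sum_group I M))"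
proof -
  obtain d where "f = diag_endo I M d"
    and "\<And>i. i \<in> I \<Longrightarrow> d i \<in> module_endos A (M i) (act i)"
    and "\<And>i. i \<in> I \<Longrightarrow> d i \<noteq> \<zero>\<^bsub>endo_ring (M i)\<^esub>"
    using f by (auto simp: diag_endos_nz_def PiE_mem simp del: endo_ring_simps)
  then show ?thesis
    using simple_right_module.schur[OF M] M
    by (auto intro!: bij_betw_diag_endo I comm_group.axioms right_module.axioms
        simple_right_module.axioms simp del: endo_ring_simps)
qed

text \<open>Both factors are diagonal, so the claim can be checked entry by entry, where it is the
  \<open>A\<close>-linearity of \<open>d i\<close>. This provides the centrality required of
  denominators.\<close>

lemma diag_endos_nz_commute:
  assumes I: "finite I" and M: "\<And>i. i \<in> I \<Longrightarrow> right_module A (M i) (act i)"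
    and f: "f \<in> diag_endos_nz A I M act" and a: "a \<in> carrier A"
  shows "f \<otimes>\<^bsub>endo_ring (sum_group I M)\<^esub> sum_action I M act a
    = sum_action I M act a \<otimes>\<^bsub>endo_ring (sum_group I M)\<^esub> f"
proof -
  obtain d where fd: "f = diag_endo I M d" and d: "\<And>i. i \<in> I \<Longrightarrow> d i \<in> module_endos A (M i) (act i)"
    using f by (auto simp: diag_endos_nz_def PiE_mem)
  have "group (M i)" if "i \<in> I" for i
    by (rule comm_group.axioms(2), rule right_module.axioms(2), rule M, rule that)
  then have car: "carrier (sum_group I M) = (\<Pi>\<^sub>E i\<in>I. carrier (M i))"
    using I by (simp add: carrier_sum_group)
  have d_cl: "d i (x i) \<in> carrier (M i)" if "x \<in> (\<Pi>\<^sub>E i\<in>I. carrier (M i))" "i \<in> I" for x i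
    using d[OF that(2)] PiE_mem[OF that] by (auto simp: module_endos_def intro: hom_in_carrier)
  have act_cl: "act i a (x i) \<in> carrier (M i)" if "x \<in> (\<Pi>\<^sub>E i\<in>I. carrier (M i))" "i \<in> I" for x i
    using ring_hom_closed[OF right_module.structure_morphism[OF M[OF that(2)]] a] PiE_mem[OF that]
    by (auto intro: hom_in_carrier)
  have lin: "d i (act i a (x i)) = act i a (d i (x i))"
    if "x \<in> (\<Pi>\<^sub>E i\<in>I. carrier (M i))" "i \<in> I" for x i
    using d[OF that(2)] a PiE_mem[OF that] by (auto simp: module_endos_def)
  show ?thesis
    by (auto simp: fd sum_action_def diag_endo_def compose_def car d_cl act_cl lin
        intro!: restrict_ext)
qed

section \<open>The universal property\<close>

text \<open>On \<open>carrier A\<close>, \<eta> is pinned to the structure morphism of the direct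
  sum. Requiring \<rho> to be extensional turns uniqueness on the carrier of
  \<open>A\<^sub>M\<close> into equality of functions.\<close>

theorem lemma8:
  fixes A :: "('a, 'x) ring_scheme"
    and r :: nat
    and M :: "nat \<Rightarrow> ('m, 'y) monoid_scheme"
    and act :: "nat \<Rightarrow> 'a \<Rightarrow> 'm \<Rightarrow> 'm"
  defines "A\<^sub>M \<equiv> local_function_ring A {1..r} M act"
    and "D\<^sub>M_units \<equiv> diag_endos_nz A {1..r} M act"
  assumes "ring A"
    and "\<And>i. i \<in> {1..r} \<Longrightarrow> simple_right_module A (M i) (act i)"
  shows "\<exists>\<eta> \<in> ring_hom A A\<^sub>M.
      (\<forall>a\<in>carrier A. \<eta> a = sum_action {1..r} M act a) \<and>
      (\<forall>s\<in>carrier A. \<eta> s \<in> D\<^sub>M_units \<longrightarrow> \<eta> s \<in> Units A\<^sub>M) \<and>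
      (\<forall>(B :: 'b ring) \<kappa>.
        ring B \<and> \<kappa> \<in> ring_hom A B \<and>
        (\<forall>s\<in>carrier A. \<eta> s \<in> D\<^sub>M_units \<longrightarrow> \<kappa> s \<in> Units B) \<and>
        a_kernel A A\<^sub>M \<eta> \<subseteq> a_kernel A B \<kappa> \<longrightarrow>
        (\<exists>!\<rho>. \<rho> \<in> ring_hom A\<^sub>M B \<inter> extensional (carrier A\<^sub>M) \<and>
          (\<forall>a\<in>carrier A. \<rho> (\<eta> a) = \<kappa> a)))"
proof -
  define E where "E = endo_ring (sum_group {1..r} M)"
  define \<eta> where "\<eta> = sum_action {1..r} M act"
  define S where "S = {s \<in> carrier A. \<eta> s \<in> D\<^sub>M_units}"
  define gens where "gens = \<eta> ` carrier A \<union> (\<lambda>s. inv\<^bsub>E\<^esub> (\<eta> s)) ` S"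
  have A\<^sub>M: "A\<^sub>M = E\<lparr>carrier := generate_ring E gens\<rparr>"
  proof -
    have "{inv\<^bsub>E\<^esub> (\<eta> s) | s. s \<in> carrier A \<and> \<eta> s \<in> D\<^sub>M_units} = (\<lambda>s. inv\<^bsub>E\<^esub> (\<eta> s)) ` S"
      by (auto simp: S_def)
    then show ?thesis
      unfolding A\<^sub>M_def local_function_ring_def Let_def gens_def E_def \<eta>_def D\<^sub>M_units_def
      by (simp only:)
  qed
  have M: "right_module A (M i) (act i)" if "i \<in> {1..r}" for i
    using assms(4)[OF that] by (rule simple_right_module.axioms)
  interpret sum: right_module A "sum_group {1..r} M" \<eta>
    unfolding \<eta>_def using \<open>ring A\<close> M by (intro right_module_sum_group) auto
  interpret E: ring E
    unfolding E_def by (rule sum.M.ring_endo_ring)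
  have \<eta>: "\<eta> \<in> ring_hom A E"
    unfolding E_def by (rule sum.structure_morphism)
  \<comment> \<open>These are units of the ambient ring \<open>E\<close>, by Schur's lemma in each
    component; invertibility inside \<open>A\<^sub>M\<close> is a separate step.\<close>
  have units: "\<eta> s \<in> Units E" if "s \<in> S" for s
    unfolding E_def
  proof (rule sum.M.endo_ring_UnitsI)
    show "\<eta> s \<in> carrier (endo_ring (sum_group {1..r} M))"
      using that ring_hom_closed[OF \<eta>] unfolding S_def E_def by blast
    show "bij_betw (\<eta> s) (carrier (sum_group {1..r} M)) (carrier (sum_group {1..r} M))"
      using that assms(4) unfolding S_def D\<^sub>M_units_def by (blast intro: diag_endos_nz_bij)
  qed
  have central: "\<eta> s \<otimes>\<^bsub>E\<^esub> \<eta> a = \<eta> a \<otimes>\<^bsub>E\<^esub> \<eta> s" if "s \<in> S" "a \<in> carrier A" for s a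
    using that M unfolding E_def S_def D\<^sub>M_units_def \<eta>_def
    by (blast intro: diag_endos_nz_commute)
  have gens: "h \<in> carrier A\<^sub>M" if "h \<in> gens" for h
    using that by (simp add: A\<^sub>M generate_ring.incl)
  have \<eta>_hom: "\<eta> \<in> ring_hom A A\<^sub>M"
    using \<eta> gens by (auto simp: A\<^sub>M gens_def ring_hom_def)
  have \<eta>_units: "\<eta> s \<in> Units A\<^sub>M" if "s \<in> S" for s
  proof -
    \<comment> \<open>The inverse formed in \<open>E\<close> is itself one of the generators, so it
      already lies in \<open>A\<^sub>M\<close>.\<close>
    have "\<eta> s \<in> carrier A\<^sub>M" "inv\<^bsub>E\<^esub> (\<eta> s) \<in> carrier A\<^sub>M"
      using that by (auto intro!: gens simp: gens_def S_def)
    moreover have "inv\<^bsub>E\<^esub> (\<eta> s) \<otimes>\<^bsub>A\<^sub>M\<^esub> \<eta> s = \<one>\<^bsub>A\<^sub>M\<^esub>" "\<eta> s \<otimes>\<^bsub>A\<^sub>M\<^esub> inv\<^bsub>E\<^esub> (\<eta> s) = \<one>\<^bsub>A\<^sub>M\<^esub>"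
      using units[OF that] by (simp_all add: A\<^sub>M)
    ultimately show ?thesis
      unfolding Units_def by blast
  qed
  have univ: "\<exists>!\<rho>. \<rho> \<in> ring_hom A\<^sub>M B \<inter> extensional (carrier A\<^sub>M) \<and> (\<forall>a\<in>carrier A. \<rho> (\<eta> a) = \<kappa> a)"
    if B: "ring B" and \<kappa>: "\<kappa> \<in> ring_hom A B" and \<kappa>_units: "\<forall>s\<in>S. \<kappa> s \<in> Units B"
      and ker: "a_kernel A A\<^sub>M \<eta> \<subseteq> a_kernel A B \<kappa>"
    for B :: "'b ring" and \<kappa>
  proof -
    interpret B: ring B
      by (rule B)
    \<comment> \<open>\<open>A\<^sub>M\<close> and \<open>E\<close> have the same zero, so the
      kernel of \<eta> is the same for both codomains.\<close>
    interpret ring_hom_pair A E B \<eta> \<kappa>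
      using \<eta> \<kappa> ker by unfold_locales (auto simp: a_kernel_def' A\<^sub>M)
    \<comment> \<open>Units in \<open>E\<close> come from Schur's lemma, units in \<open>B\<close>
      from the hypothesis on \<kappa>, and commutation from the diagonal form.\<close>
    have "S \<subseteq> denominators"
      using units central \<kappa>_units by (auto simp: denominators_def S_def)
    from ex1_hom_from_generated[OF this] show ?thesis
      by (simp add: A\<^sub>M gens_def)
  qed
  show ?thesis
    using \<eta>_hom \<eta>_units univ by (intro bexI[of _ \<eta>]) (auto simp: S_def \<eta>_def)
qed

end
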